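(* Let $x_*$ be a feasible point of problem $(\mathcal{P})$ and $\mathcal{D}(x_* )=\partial F(x_* )+\mathcal{N}(x_* )+N_A(x_* )$. If a generalised complete alternance exists at $x_*$, then $0\in\operatorname{int}\mathcal{D}(x_* )$ and $\partial F(x_* )\ne\{0\}$. Conversely, if $0\in\operatorname{int}\mathcal{D}(x_* )$, $\partial F(x_* )\ne\{0\}$, and one of the following holds: (i) $\operatorname{int}\partial F(x_* )\ne\emptyset$; (ii) $\mathcal{N}(x_* )+N_A(x_* )\ne\mathbb{R}^d$ and either $\operatorname{int}\mathcal{N}(x_* )\ne\emptyset$ or $\operatorname{int}N_A(x_* )\ne\emptyset$; (iii) $N_A(x_* )=\{0\}$ and there exists $w\in\operatorname{relint}\mathcal{N}(x_* )\setminus\{0\}$ with $0\in\partial F(x_* )+w$ (in particular, it suffices that $N_A(x_* )=\{0\}$ and either $0\notin\partial F(x_* )$ or the cone $\mathcal{N}(x_* )$ is pointed); (iv) $\mathcal{N}(x_* )=\{0\}$ and there exists $w\in\operatorname{relint}N_A(x_* )\setminus\{0\}$ with $0\in\partial F(x_* )+w$, then a generalised complete alternance exists at $x_*$.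
   Context: Setting: $A\subseteq\mathbb{R}^d$ nonempty closed convex; $Y$ real Banach space with dual $Y^*$, pairing $\langle\cdot,\cdot\rangle$; $K\subset Y$ nonempty closed convex cone; $W$ compact Hausdorff; $f:\mathbb{R}^d\times W\to\mathbb{R}$ differentiable in $x$ with $f,\nabla_xf$ jointly continuous; $G:\mathbb{R}^d\to Y$ continuously Fréchet differentiable. $F(x)=\max_\omega f(x,\omega)$, $W(x)=\{\omega:f(x,\omega)=F(x)\}$, $\partial F(x)=\operatorname{co}\{\nabla_xf(x,\omega):\omega\in W(x)\}$; problem $(\mathcal{P})$: minimise $F$ s.t. $G(x)\in K$, $x\in A$. $K^*=\{y^*:\langle y^*,y\rangle\le0\ \forall y\in K\}$; $\mathcal{N}(x)=\{[DG(x)]^*\lambda:\lambda\in K^*,\langle\lambda,G(x)\rangle=0\}$ where $\langle[DG(x)]^*\lambda,h\rangle=\langle\lambda,DG(x)h\rangle$; $N_A(x)$ is the normal cone of convex analysis to $A$ at $x$. A cone $\mathcal{C}$ is pointed if $\mathcal{C}\cap(-\mathcal{C})=\{0\}$. Fix $Z\subset\mathbb{R}^d$ consisting of $d$ linearly independent vectors. A generalised complete alternance exists at $x_*$ if there exist $k_0\in\{1,\dots,d+1\}$, $i_0\in\{k_0,\dots,d+1\}$ and vectors $V_1,\dots,V_{k_0}\in\partial F(x_* )$, $V_{k_0+1},\dots,V_{i_0}\in\mathcal{N}(x_* )$, $V_{i_0+1},\dots,V_{d+1}\in N_A(x_* )$ (empty ranges allowed) such that the determinants $\Delta_s=\det[V_1,\dots,V_{s-1},V_{s+1},\dots,V_{d+1}]$,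 $s=1,\dots,d+1$, are all nonzero and $\operatorname{sign}\Delta_s=-\operatorname{sign}\Delta_{s+1}$ for $s=1,\dots,d$. *)

theory Defs
  imports "HOL-Analysis.Analysis"
begin

definition maxfun :: "('x \<Rightarrow> 'w \<Rightarrow> real) \<Rightarrow> 'w set \<Rightarrow> 'x \<Rightarrow> real" where
  "maxfun f W x = (SUP w\<in>W. f x w)"

definition active_set :: "('x \<Rightarrow> 'w \<Rightarrow> real) \<Rightarrow> 'w set \<Rightarrow> 'x \<Rightarrow> 'w set" where
  "active_set f W x = {w \<in> W. f x w = maxfun f W x}"

text \<open>Subdifferential of F: convex hull of the gradients over the active set
  (df x w is the gradient of f(.,w) at x).\<close>
definition subdiffF :: "('x \<Rightarrow> 'w \<Rightarrow> real) \<Rightarrow> ('x \<Rightarrow> 'w \<Rightarrow> 'v::real_vector) \<Rightarrow> 'w set \<Rightarrow> 'x \<Rightarrow> 'v set" where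
  "subdiffF f df W x = convex hull ((\<lambda>w. df x w) ` active_set f W x)"

definition polar_cone :: "'y::real_normed_vector set \<Rightarrow> ('y \<Rightarrow>\<^sub>L real) set" where
  "polar_cone K = {l. \<forall>y\<in>K. blinfun_apply l y \<le> 0}"

text \<open>The cone N(x) = {[DG(x)]^* l : l in K*, l(G(x)) = 0}; the adjoint [DG(x)]^* l is the
  (unique) vector v with v . h = l(DG(x) h) for all h.\<close>
definition cone_N :: "('x::real_inner \<Rightarrow> 'y::real_normed_vector) \<Rightarrow> ('x \<Rightarrow> ('x \<Rightarrow>\<^sub>L 'y)) \<Rightarrow> 'y set \<Rightarrow> 'x \<Rightarrow> 'x set" where
  "cone_N G DG K x = {v. \<exists>l \<in> polar_cone K. blinfun_apply l (G x) = 0 \<and>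
       (\<forall>h. inner v h = blinfun_apply l (blinfun_apply (DG x) h))}"

definition normal_cone :: "'x::real_inner set \<Rightarrow> 'x \<Rightarrow> 'x set" where
  "normal_cone A x = {v. \<forall>y\<in>A. inner v (y - x) \<le> 0}"

definition sum3 :: "'x::real_vector set \<Rightarrow> 'x set \<Rightarrow> 'x set \<Rightarrow> 'x set" where
  "sum3 P Q R = {a + b + c |a b c. a \<in> P \<and> b \<in> Q \<and> c \<in> R}"

definition pointed_cone :: "'x::real_vector set \<Rightarrow> bool" where
  "pointed_cone C \<longleftrightarrow> C \<inter> uminus ` C = {0}"

text \<open>A fixed enumeration of the coordinate index type by {1..d}, d = CARD('n).
  Determinants below are taken w.r.t. this ordering; the alternance condition is
  invariant under the choice (a reordering multiplies all Delta_s by the same sign).\<close>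
definition idx_enum :: "'n::finite \<Rightarrow> nat" where
  "idx_enum = (SOME e. bij_betw e (UNIV::'n set) {1..CARD('n)})"

definition skip :: "nat \<Rightarrow> nat \<Rightarrow> nat" where
  "skip s k = (if k < s then k else k + 1)"

text \<open>Delta_s = det[V_1,...,V_{s-1},V_{s+1},...,V_{d+1}] (taken as rows; det of transpose is equal).\<close>
definition Delta :: "(nat \<Rightarrow> real^'n::finite) \<Rightarrow> nat \<Rightarrow> real" where
  "Delta V s = det (\<chi> j. V (skip s (idx_enum j)) :: real^'n^'n)"

definition gen_complete_alternance :: "(real^'n::finite) set \<Rightarrow> (real^'n) set \<Rightarrow> (real^'n) set \<Rightarrow> bool" where
  "gen_complete_alternance dF N NA \<longleftrightarrow>
     (\<exists>k0 i0 (V :: nat \<Rightarrow> real^'n).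
        1 \<le> k0 \<and> k0 \<le> CARD('n) + 1 \<and> k0 \<le> i0 \<and> i0 \<le> CARD('n) + 1 \<and>
        (\<forall>i\<in>{1..k0}. V i \<in> dF) \<and>
        (\<forall>i\<in>{k0+1..i0}. V i \<in> N) \<and>
        (\<forall>i\<in>{i0+1..CARD('n)+1}. V i \<in> NA) \<and>
        (\<forall>s\<in>{1..CARD('n)+1}. Delta V s \<noteq> 0) \<and>
        (\<forall>s\<in>{1..CARD('n)}. sgn (Delta V s) = - sgn (Delta V (s + 1))))"

end

theory Submission
  imports Defs
begin

text \<open>For a linear relation with coefficients \<open>\<alpha> i\<close> among \<open>d + 1\<close> vectors, exchanging neighbouring rows gives
  \<open>\<alpha> (s + 1) \<Delta> s = - \<alpha> s \<Delta> (s + 1)\<close>. Hence alternating nonzero determinants mean exactly that the vectors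
  span the space and admit a relation with positive coefficients, that is, no nonzero functional is nonnegative
  on all of them. The forward direction follows by separating \<open>0\<close> from the interior of \<open>D\<close>. Conversely, such
  vectors are found by writing \<open>0\<close> as a sum of points of the three sets, one of them in the (relative) interior of
  its set, and replacing that point by the vertices of a small simplex around it.\<close>

section \<open>Alternating determinants and positive relations\<close>

text \<open>By Steinitz, \<open>0\<close> in the interior of a convex hull may need as many as
  \<open>2d\<close> points, as the vectors of a basis and their negatives show. An alternance has
  room for \<open>d + 1\<close> vectors only and must use one from the subdifferential. This count
  shapes the converse. If the balance point lies in the interior of one set, the points taken from
  the other two can be thinned out to \<open>m\<close> linearly independent ones; a simplex in the
  remaining \<open>d - m\<close> basis directions has \<open>d - m + 1\<close> vertices, which makes
  \<open>d + 1\<close> in all. With a relative interior point of a cone, two simplices are needed,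
  one in the span of the cone and one in a complement, and the naive count is \<open>d + 2\<close>.
  A nonzero balance point saves one vector, because it can itself be an element of the basis of that
  span. Only upper bounds on the number of vectors have to be tracked, since a positively spanning
  set never has fewer than \<open>d + 1\<close> elements.\<close>

lemma idx_enum_bij: "bij_betw (idx_enum :: 'n::finite \<Rightarrow> nat) UNIV {1..CARD('n)}"
proof -
  have "\<exists>e. bij_betw e (UNIV :: 'n set) {1..CARD('n)}"
    by (metis finite_class.finite_UNIV bij_betw_inv ex_bij_betw_nat_finite_1)
  then show ?thesis
    unfolding idx_enum_def by (rule someI_ex)
qed

lemma range_skip_idx_enum:
  "range (\<lambda>j::'n::finite. V (skip 1 (idx_enum j))) = V ` {2..CARD('n) + 1}"
proof -
  have "skip 1 (idx_enum j) = Suc (idx_enum j)" for j :: 'n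
    using bij_betwE[OF idx_enum_bij[where 'n='n]] by (auto simp: skip_def Suc_le_eq)
  then have "range (\<lambda>j::'n. V (skip 1 (idx_enum j))) = V ` Suc ` range (idx_enum :: 'n \<Rightarrow> nat)"
    by (simp only: image_image)
  also have "Suc ` range (idx_enum :: 'n \<Rightarrow> nat) = {2..CARD('n) + 1}"
    using idx_enum_bij[where 'n='n] by (simp add: bij_betw_def image_Suc_atLeastAtMost numeral_2_eq_2)
  finally show ?thesis .
qed

text \<open>The rows are exactly \<open>V 2\<close>, ..., \<open>V (d + 1)\<close>. The index
  \<open>1\<close> is enough: the adjacent-row identity below carries nonvanishing on to the other
  determinants.\<close>

lemma Delta_1_nonzero_iff_span:
  fixes V :: "nat \<Rightarrow> real^'n"
  shows "Delta V 1 \<noteq> 0 \<longleftrightarrow> span (V ` {2..CARD('n) + 1}) = UNIV"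
proof -
  let ?A = "\<chi> j. V (skip 1 (idx_enum j)) :: real^'n^'n"
  have "rows ?A = V ` {2..CARD('n) + 1}"
    unfolding range_skip_idx_enum[symmetric] rows_def row_def by auto
  then show ?thesis
    unfolding Delta_def
    by (metis invertible_det_nz invertible_left_inverse matrix_left_invertible_span_rows)
qed

text \<open>The matrices of \<^term>\<open>Delta V s\<close> and \<^term>\<open>Delta V (s + 1)\<close> differ in a single row, and the
  linear relation puts a combination of these two rows into the span of the remaining ones.\<close>

lemma Delta_adjacent:
  fixes V :: "nat \<Rightarrow> real^'n"
  assumes rel: "(\<Sum>i=1..CARD('n) + 1. \<alpha> i *\<^sub>R V i) = 0" and s: "s \<in> {1..CARD('n)}"
  shows "\<alpha> (s + 1) * Delta V s = - \<alpha> s * Delta V (s + 1)"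
proof -
  let ?I = "{1..CARD('n) + 1}"
  obtain j0 :: 'n where j0: "idx_enum j0 = s"
    using idx_enum_bij[where 'n='n] s by (metis bij_betw_iff_bijections)
  have inj: "inj (idx_enum :: 'n \<Rightarrow> nat)"
    using idx_enum_bij bij_betw_def by blast
  define R where "R j = V (skip s (idx_enum j))" for j :: 'n
  \<comment> \<open>The determinant as a linear function of the one row in which the two matrices
    differ.\<close>
  define M where "M x = det (\<chi> j. if j = j0 then x else R j)" for x
  have D1: "Delta V s = M (V (s + 1))"
    unfolding Delta_def M_def using j0
    by (intro arg_cong[where f=det]) (auto simp: vec_eq_iff R_def skip_def)
  have "V (skip (s + 1) (idx_enum j)) = (if j = j0 then V s else R j)" for j :: 'n
    using j0 inj_eq[OF inj, of j j0] by (auto simp: R_def skip_def)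
  then have D2: "Delta V (s + 1) = M (V s)"
    by (simp add: Delta_def M_def)
  have add: "M (x + y) = M x + M y" for x y
    unfolding M_def using det_row_add[of j0 "\<lambda>_. x" "\<lambda>_. y" R] by simp
  have mul: "M (c *\<^sub>R x) = c * M x" for c x
    unfolding M_def using det_row_mul[of j0 c "\<lambda>_. x" R] by (simp add: scalar_mult_eq_scaleR cong: if_cong)
  define x where "x = \<alpha> s *\<^sub>R V s + \<alpha> (s + 1) *\<^sub>R V (s + 1)"
  let ?J = "?I - {s, s + 1}"
  have "(\<Sum>i\<in>?I. \<alpha> i *\<^sub>R V i) = x + (\<Sum>i\<in>?J. \<alpha> i *\<^sub>R V i)"
    using s sum.subset_diff[of "{s, s + 1}" ?I "\<lambda>i. \<alpha> i *\<^sub>R V i"] by (simp add: x_def)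
  then have x: "x = - (\<Sum>i\<in>?J. \<alpha> i *\<^sub>R V i)"
    using rel by (simp add: eq_neg_iff_add_eq_0)
  have "V i \<in> {R j |j. j \<noteq> j0}" if "i \<in> ?J" for i
  proof -
    \<comment> \<open>The inverse of \<open>skip s\<close>, so that every vector other than
      \<open>V s\<close> and \<open>V (s + 1)\<close> is found among the rows common to both
      matrices.\<close>
    define k where "k = (if i < s then i else i - 1)"
    have "k \<in> {1..CARD('n)}" "k \<noteq> s" "skip s k = i"
      using that s by (auto simp: k_def skip_def)
    moreover obtain j :: 'n where "idx_enum j = k"
      using idx_enum_bij[where 'n='n] \<open>k \<in> {1..CARD('n)}\<close> by (metis bij_betw_iff_bijections)
    ultimately show ?thesis
      using j0 by (auto simp: R_def)
  qed
  then have sp: "x \<in> span {R j |j. j \<noteq> j0}"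
    unfolding x by (intro span_neg span_sum span_scale span_base) auto
  \<comment> \<open>Adding to the zero row of \<open>?A\<close> a vector from the span of the other
    rows leaves its determinant \<open>0\<close> unchanged, hence \<open>M x = 0\<close>. Expanding
    \<open>M x\<close> by linearity is the claimed identity.\<close>
  let ?A = "(\<chi> j. if j = j0 then 0 else R j) :: real^'n^'n"
  have "{row j ?A |j. j \<noteq> j0} = {R j |j. j \<noteq> j0}"
    by (auto simp: row_def)
  then have "det (\<chi> k. if k = j0 then row j0 ?A + x else row k ?A) = det ?A"
    using sp by (intro det_row_span) (simp add: span_vec_eq)
  moreover have "(\<chi> k. if k = j0 then row j0 ?A + x else row k ?A) = (\<chi> j. if j = j0 then x else R j)"
    by (auto simp: vec_eq_iff row_def)
  moreover have "det ?A = 0"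
    by (rule det_zero_row(1)[of j0]) (simp add: row_def vec_eq_iff)
  ultimately have "M x = 0"
    by (simp add: M_def)
  then show ?thesis
    unfolding D1 D2 x_def add mul by simp
qed

text \<open>Since \<open>Delta V 1\<close> is nonzero, \<open>V 1\<close> is a combination of the
  other vectors, which gives a relation with coefficient \<open>1\<close> at \<open>V 1\<close>. By
  the adjacent-row identity the sign change from \<open>Delta V s\<close> to
  \<open>Delta V (s + 1)\<close> passes positivity from \<open>\<alpha> s\<close> to
  \<open>\<alpha> (s + 1)\<close>.\<close>

lemma alternating_Delta_positive_relation:
  fixes V :: "nat \<Rightarrow> real^'n"
  assumes nz: "\<forall>s\<in>{1..CARD('n) + 1}. Delta V s \<noteq> 0"
    and alt: "\<forall>s\<in>{1..CARD('n)}. sgn (Delta V s) = - sgn (Delta V (s + 1))"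
  obtains \<alpha> where "\<And>i. i \<in> {1..CARD('n) + 1} \<Longrightarrow> \<alpha> i > 0"
    and "(\<Sum>i=1..CARD('n) + 1. \<alpha> i *\<^sub>R V i) = 0"
proof -
  let ?e = "inv_into UNIV (idx_enum :: 'n \<Rightarrow> nat)"
  let ?A = "\<chi> j. V (skip 1 (idx_enum j)) :: real^'n^'n"
  have e: "?e (idx_enum j) = j" for j :: 'n
    using idx_enum_bij by (metis bij_betw_def inv_into_f_f UNIV_I)
  have "Delta V 1 \<noteq> 0" using nz by auto
  then obtain B where B: "B ** ?A = mat 1"
    unfolding Delta_def by (metis invertible_det_nz invertible_left_inverse)
  define y where "y = V 1 v* B"
  have "V 1 = y v* ?A"
    unfolding y_def vector_matrix_mul_assoc B by simp
  also have "\<dots> = (\<Sum>j\<in>UNIV. y $ j *\<^sub>R V (skip 1 (idx_enum j)))"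
    by (simp add: vec_eq_iff vector_matrix_mult_def)
  also have "\<dots> = (\<Sum>j\<in>(UNIV::'n set). y $ ?e (idx_enum j) *\<^sub>R V (idx_enum j + 1))"
  proof (rule sum.cong)
    fix j :: 'n
    have "idx_enum j \<in> {1..CARD('n)}"
      using bij_betwE[OF idx_enum_bij] by blast
    then show "y $ j *\<^sub>R V (skip 1 (idx_enum j)) = y $ ?e (idx_enum j) *\<^sub>R V (idx_enum j + 1)"
      by (simp add: e skip_def)
  qed simp
  also have "\<dots> = (\<Sum>i=1..CARD('n). y $ ?e i *\<^sub>R V (i + 1))"
    by (rule sum.reindex_bij_betw[OF idx_enum_bij])
  finally have V1: "V 1 = (\<Sum>i=1..CARD('n). y $ ?e i *\<^sub>R V (i + 1))" .
  \<comment> \<open>The shift by one appears because row \<open>j\<close> of \<open>?A\<close> holds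
    \<open>V (idx_enum j + 1)\<close>.\<close>
  define \<alpha> where "\<alpha> i = (if i = 1 then 1 else - y $ ?e (i - 1))" for i
  have "(\<Sum>i=1..CARD('n) + 1. \<alpha> i *\<^sub>R V i) = \<alpha> 1 *\<^sub>R V 1 + (\<Sum>i=2..CARD('n) + 1. \<alpha> i *\<^sub>R V i)"
    by (subst sum.atLeast_Suc_atMost) (auto simp: numeral_2_eq_2)
  also have "(\<Sum>i=2..CARD('n) + 1. \<alpha> i *\<^sub>R V i) = (\<Sum>i=1..CARD('n). \<alpha> (i + 1) *\<^sub>R V (i + 1))"
    using sum.shift_bounds_cl_nat_ivl[of "\<lambda>i. \<alpha> i *\<^sub>R V i" 1 1 "CARD('n)"]
    by (simp add: numeral_2_eq_2)
  also have "\<dots> = - V 1"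
    by (subst V1, subst sum_negf[symmetric], rule sum.cong) (auto simp: \<alpha>_def)
  finally have rel: "(\<Sum>i=1..CARD('n) + 1. \<alpha> i *\<^sub>R V i) = 0"
    by (simp add: \<alpha>_def)
  have pos: "1 \<le> i \<longrightarrow> i \<le> CARD('n) + 1 \<longrightarrow> \<alpha> i > 0" for i
  proof (induction i)
    case (Suc i)
    show ?case
    proof (cases "i = 0")
      case False
      show ?thesis
      proof (intro impI)
        assume "Suc i \<le> CARD('n) + 1"
        then have i: "i \<in> {1..CARD('n)}" "\<alpha> i > 0"
          using False Suc by auto
        have "\<alpha> (i + 1) * Delta V i = - \<alpha> i * Delta V (i + 1)"
          by (rule Delta_adjacent[OF rel i(1)])
        then have "sgn (\<alpha> (i + 1)) * sgn (Delta V i) = - sgn (Delta V (i + 1))"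
          using i(2) by (metis mult_minus_left sgn_minus sgn_mult sgn_pos mult_1)
        moreover have "sgn (Delta V i) = - sgn (Delta V (i + 1))" "sgn (Delta V i) \<noteq> 0"
          using alt nz i(1) by (auto simp: sgn_eq_0_iff)
        ultimately have "sgn (\<alpha> (i + 1)) = 1"
          by (metis mult_cancel_right1)
        then show "\<alpha> (Suc i) > 0"
          by (simp add: sgn_1_pos)
      qed
    qed (simp add: \<alpha>_def)
  qed simp
  show ?thesis
    by (rule that[OF _ rel]) (use pos in auto)
qed

text \<open>As \<open>\<alpha> 1\<close> is nonzero, \<open>V 1\<close> is redundant in the span, so
  the other \<open>d\<close> vectors already span and \<open>Delta V 1\<close> is nonzero. The
  adjacent-row identity with positive coefficients then gives nonvanishing by induction, and its
  signs give the alternation.\<close>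

lemma positive_relation_alternating_Delta:
  fixes V :: "nat \<Rightarrow> real^'n"
  assumes pos: "\<And>i. i \<in> {1..CARD('n) + 1} \<Longrightarrow> \<alpha> i > 0"
    and rel: "(\<Sum>i=1..CARD('n) + 1. \<alpha> i *\<^sub>R V i) = 0"
    and span: "span (V ` {1..CARD('n) + 1}) = UNIV"
  shows "\<forall>s\<in>{1..CARD('n) + 1}. Delta V s \<noteq> 0"
    and "\<forall>s\<in>{1..CARD('n)}. sgn (Delta V s) = - sgn (Delta V (s + 1))"
proof -
  let ?S = "V ` {2..CARD('n) + 1}"
  have adj: "\<alpha> (s + 1) * Delta V s = - \<alpha> s * Delta V (s + 1)" if "s \<in> {1..CARD('n)}" for s
    by (rule Delta_adjacent[OF rel that])
  have "(\<Sum>i=1..CARD('n) + 1. \<alpha> i *\<^sub>R V i) = \<alpha> 1 *\<^sub>R V 1 + (\<Sum>i=2..CARD('n) + 1. \<alpha> i *\<^sub>R V i)"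
    by (subst sum.atLeast_Suc_atMost) (auto simp: numeral_2_eq_2)
  then have "\<alpha> 1 *\<^sub>R V 1 = - (\<Sum>i=2..CARD('n) + 1. \<alpha> i *\<^sub>R V i)"
    using rel by (metis eq_neg_iff_add_eq_0)
  also have "\<dots> \<in> span ?S"
    by (intro span_neg span_sum span_scale span_base) auto
  finally have "V 1 \<in> span ?S"
    using pos[of 1] span_scale[of "\<alpha> 1 *\<^sub>R V 1" ?S "inverse (\<alpha> 1)"] by simp
  moreover have "V ` {1..CARD('n) + 1} = insert (V 1) ?S"
    by (subst atLeastAtMost_insertL[symmetric]) (auto simp: numeral_2_eq_2)
  ultimately have "span ?S = UNIV"
    using span span_redundant by metis
  then have D1: "Delta V 1 \<noteq> 0"
    by (simp only: Delta_1_nonzero_iff_span not_False_eq_True)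
  have "1 \<le> s \<longrightarrow> s \<le> CARD('n) + 1 \<longrightarrow> Delta V s \<noteq> 0" for s
  proof (induction s)
    case (Suc s)
    show ?case
    proof (cases "s = 0")
      case False
      then show ?thesis
        using Suc adj[of s] pos[of "s + 1"] by auto
    qed (use D1 in simp)
  qed simp
  then show "\<forall>s\<in>{1..CARD('n) + 1}. Delta V s \<noteq> 0"
    by auto
  show "\<forall>s\<in>{1..CARD('n)}. sgn (Delta V s) = - sgn (Delta V (s + 1))"
  proof
    fix s assume s: "s \<in> {1..CARD('n)}"
    then have "sgn (\<alpha> (s + 1)) = 1" "sgn (\<alpha> s) = 1"
      using pos[of s] pos[of "s + 1"] by auto
    then show "sgn (Delta V s) = - sgn (Delta V (s + 1))"
      using arg_cong[OF adj[OF s], of sgn] by (simp add: sgn_mult sgn_minus)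
  qed
qed

section \<open>Positively spanning sets\<close>

text \<open>Dual form of the property that nonnegative combinations of \<open>F\<close> fill the
  space. It is checked one functional at a time, without exhibiting coefficients.\<close>

definition positively_spanning :: "'a::euclidean_space set \<Rightarrow> bool" where
  "positively_spanning F \<longleftrightarrow> (\<forall>a. (\<forall>v\<in>F. 0 \<le> a \<bullet> v) \<longrightarrow> a = 0)"

text \<open>If the interior is empty, \<open>S\<close> lies in a hyperplane, and the sign of its
  level decides between \<open>a\<close> and \<open>- a\<close>. Otherwise \<open>0\<close> is
  separated from the interior, and the inequality extends to \<open>S\<close> because
  \<open>S\<close> lies in the closure of its interior.\<close>

lemma not_interior_supporting:
  fixes S :: "'a::euclidean_space set"
  assumes "convex S" "0 \<notin> interior S"
  obtains a where "a \<noteq> 0" "\<And>x. x \<in> S \<Longrightarrow> 0 \<le> a \<bullet> x"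
proof (cases "interior S = {}")
  case True
  then obtain a b where ab: "a \<noteq> 0" "S \<subseteq> {x. a \<bullet> x = b}"
    using empty_interior_subset_hyperplane[OF assms(1)] by metis
  show ?thesis
  proof (cases "0 \<le> b")
    case True
    then show ?thesis using that[of a] ab by auto
  next
    case False
    then show ?thesis using that[of "- a"] ab by force
  qed
next
  case False
  obtain a where a: "a \<noteq> 0" "\<forall>x\<in>interior S. 0 \<le> a \<bullet> x"
    using separating_hyperplane_set_0[OF convex_interior[OF assms(1)] assms(2)] by blast
  have "closure (interior S) \<subseteq> {x. 0 \<le> a \<bullet> x}"
    using a by (intro closure_minimal) (auto simp: closed_halfspace_ge)
  then have "S \<subseteq> {x. 0 \<le> a \<bullet> x}"
    using convex_closure_interior[OF assms(1) False] closure_subset by blast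
  then show ?thesis using that[of a] a by auto
qed

lemma positively_spanning_interior_hull:
  fixes F :: "'a::euclidean_space set"
  assumes "positively_spanning F"
  shows "0 \<in> interior (convex hull F)"
proof (rule ccontr)
  assume "0 \<notin> interior (convex hull F)"
  then obtain a where "a \<noteq> 0" "\<And>x. x \<in> convex hull F \<Longrightarrow> 0 \<le> a \<bullet> x"
    using not_interior_supporting[OF convex_convex_hull] by metis
  then show False
    using assms hull_inc unfolding positively_spanning_def by metis
qed

lemma span_positively_spanning:
  assumes "positively_spanning F"
  shows "span F = UNIV"
proof (rule ccontr)
  assume "span F \<noteq> UNIV"
  then have "dim F \<noteq> DIM('a)"
    by (simp add: dim_eq_full)
  then obtain a where "a \<noteq> 0" "\<And>x. x \<in> span F \<Longrightarrow> orthogonal a x"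
    using orthogonal_to_subspace_exists[of F] dim_subset_UNIV[of F] by (metis le_neq_implies_less)
  then show False
    using assms unfolding positively_spanning_def
    by (metis span_base orthogonal_def order_refl)
qed

text \<open>A hull with interior points has affine dimension \<open>d\<close>, which takes at least
  \<open>d + 1\<close> points. The upper bound on the cardinality is thus attained and
  \<open>F\<close> is affinely independent, so interior points of the simplex have positive
  barycentric coordinates.\<close>

lemma positively_spanning_simplex:
  fixes F :: "'a::euclidean_space set"
  assumes "positively_spanning F" "finite F" "card F \<le> DIM('a) + 1"
  obtains u where "card F = DIM('a) + 1" "\<And>x. x \<in> F \<Longrightarrow> 0 < u x" "(\<Sum>x\<in>F. u x *\<^sub>R x) = 0"
proof -
  have int: "0 \<in> interior (convex hull F)"
    by (rule positively_spanning_interior_hull[OF assms(1)])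
  have "aff_dim F = DIM('a)"
    using aff_dim_nonempty_interior[of "convex hull F"] int by (auto simp: aff_dim_convex_hull)
  moreover have "aff_dim F \<le> int (card F) - 1"
    by (rule aff_dim_le_card[OF assms(2)])
  ultimately have card: "card F = DIM('a) + 1" and "\<not> affine_dependent F"
    using assms(2,3) by (auto simp: affine_independent_iff_card)
  then have "interior (convex hull F) =
      {y. \<exists>u. (\<forall>x\<in>F. 0 < u x) \<and> sum u F = 1 \<and> (\<Sum>x\<in>F. u x *\<^sub>R x) = y}"
    by (simp add: interior_convex_hull_explicit_minimal)
  then show ?thesis
    using int card that by auto
qed

lemma positively_spanning_alternance:
  fixes F1 F2 F3 :: "(real^'n) set"
  assumes F: "F1 \<subseteq> C" "F2 \<subseteq> P" "F3 \<subseteq> Q" "finite F1" "finite F2" "finite F3"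
    and ne: "F1 \<noteq> {}"
    and card: "card F1 + card F2 + card F3 \<le> CARD('n) + 1"
    and span: "positively_spanning (F1 \<union> F2 \<union> F3)"
  shows "gen_complete_alternance C P Q"
proof -
  define F where "F = F1 \<union> F2 \<union> F3"
  have cF: "card F \<le> card F1 + card F2 + card F3"
    unfolding F_def by (meson add_le_mono1 card_Un_le le_trans)
  obtain u where u: "card F = CARD('n) + 1" "\<And>x. x \<in> F \<Longrightarrow> 0 < u x" "(\<Sum>x\<in>F. u x *\<^sub>R x) = 0"
    using positively_spanning_simplex[of F] span F card cF unfolding F_def by (auto simp: DIM_cart)
  define k0 where "k0 = card F1"
  define i0 where "i0 = k0 + card F2"
  \<comment> \<open>The union has \<open>d + 1\<close> elements while the three cardinalities sum to
    at most \<open>d + 1\<close>. So no vector is listed twice, and the concatenated enumeration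
    \<open>V\<close> is injective.\<close>
  have n: "CARD('n) + 1 = i0 + card F3"
    using u(1) cF card by (simp add: k0_def i0_def)
  obtain h1 where h1: "bij_betw h1 {1..card F1} F1"
    using ex_bij_betw_nat_finite_1 F by blast
  obtain h2 where h2: "bij_betw h2 {1..card F2} F2"
    using ex_bij_betw_nat_finite_1 F by blast
  obtain h3 where h3: "bij_betw h3 {1..card F3} F3"
    using ex_bij_betw_nat_finite_1 F by blast
  define V where "V i = (if i \<le> k0 then h1 i else if i \<le> i0 then h2 (i - k0) else h3 (i - i0))" for i
  have V1: "V i = h1 i" if "i \<in> {1..k0}" for i
    using that by (simp add: V_def)
  have V2: "V (k0 + i) = h2 i" if "i \<in> {1..card F2}" for i
    using that by (simp add: V_def i0_def)
  have V3: "V (i0 + i) = h3 i" if "i \<in> {1..card F3}" for i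
    using that by (auto simp: V_def i0_def)
  have "V ` {1..k0} = F1"
    using h1 V1 by (metis bij_betw_imp_surj_on image_cong k0_def)
  moreover have "V ` {k0 + 1..i0} = F2"
  proof -
    have "{k0 + 1..i0} = (+) k0 ` {1..card F2}"
      by (simp add: i0_def)
    then have "V ` {k0 + 1..i0} = (\<lambda>i. V (k0 + i)) ` {1..card F2}"
      by (simp only: image_image)
    also have "\<dots> = h2 ` {1..card F2}"
      using V2 by (intro image_cong) auto
    finally show ?thesis
      using bij_betw_imp_surj_on[OF h2] by simp
  qed
  moreover have "V ` {i0 + 1..CARD('n) + 1} = F3"
  proof -
    have "{i0 + 1..CARD('n) + 1} = (+) i0 ` {1..card F3}"
      using n by simp
    then have "V ` {i0 + 1..CARD('n) + 1} = (\<lambda>i. V (i0 + i)) ` {1..card F3}"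
      by (simp only: image_image)
    also have "\<dots> = h3 ` {1..card F3}"
      using V3 by (intro image_cong) auto
    finally show ?thesis
      using bij_betw_imp_surj_on[OF h3] by simp
  qed
  moreover have "{1..CARD('n) + 1} = {1..k0} \<union> {k0 + 1..i0} \<union> {i0 + 1..CARD('n) + 1}"
    using n by (auto simp: i0_def)
  ultimately have V: "V ` {1..k0} = F1" "V ` {k0 + 1..i0} = F2" "V ` {i0 + 1..CARD('n) + 1} = F3"
    "V ` {1..CARD('n) + 1} = F"
    by (auto simp: F_def image_Un)
  have "inj_on V {1..CARD('n) + 1}"
    by (rule eq_card_imp_inj_on) (simp_all only: V u(1) finite_atLeastAtMost card_atLeastAtMost)
  then have rel: "(\<Sum>i=1..CARD('n) + 1. u (V i) *\<^sub>R V i) = 0"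
    using sum.reindex[of V "{1..CARD('n) + 1}" "\<lambda>x. u x *\<^sub>R x"] V(4) u(3) by (simp only: o_def)
  have pos: "0 < u (V i)" if "i \<in> {1..CARD('n) + 1}" for i
    using u(2) V(4) that by blast
  have "span (V ` {1..CARD('n) + 1}) = UNIV"
    unfolding V(4) using span_positively_spanning[OF span] by (simp add: F_def)
  from positive_relation_alternating_Delta[of "\<lambda>i. u (V i)", OF pos rel this]
  show ?thesis
    unfolding gen_complete_alternance_def
  proof (intro exI conjI)
    show "1 \<le> k0"
      using ne F(4) by (simp add: k0_def Suc_le_eq card_gt_0_iff)
    show "\<forall>i\<in>{1..k0}. V i \<in> C" "\<forall>i\<in>{k0 + 1..i0}. V i \<in> P"
      "\<forall>i\<in>{i0 + 1..CARD('n) + 1}. V i \<in> Q"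
      using V(1-3) F(1-3) by blast+
  qed (use n in \<open>auto simp: i0_def\<close>)
qed

section \<open>Three-term sums and the forward implication\<close>

lemma sum3_subset:
  assumes "\<And>c p q. c \<in> C \<Longrightarrow> p \<in> P \<Longrightarrow> q \<in> Q \<Longrightarrow> c + p + q \<in> S"
  shows "sum3 C P Q \<subseteq> S"
  using assms by (auto simp: sum3_def)

lemma sum3I: "c \<in> C \<Longrightarrow> p \<in> P \<Longrightarrow> q \<in> Q \<Longrightarrow> x = c + p + q \<Longrightarrow> x \<in> sum3 C P Q"
  by (auto simp: sum3_def)

text \<open>Bracketed in this way, the sum is open to facts about two convex sets. Together with the
  two symmetries below, any of the three sets can be put first.\<close>

lemma sum3_eq: "sum3 C P Q = {c + y |c y. c \<in> C \<and> y \<in> {p + q |p q. p \<in> P \<and> q \<in> Q}}"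
proof (intro antisym sum3_subset subsetI)
  fix c p q assume "c \<in> C" "p \<in> P" "q \<in> Q"
  moreover have "c + p + q = c + (p + q)" by (rule add.assoc)
  ultimately show "c + p + q \<in> {c + y |c y. c \<in> C \<and> y \<in> {p + q |p q. p \<in> P \<and> q \<in> Q}}"
    by blast
next
  fix x assume "x \<in> {c + y |c y. c \<in> C \<and> y \<in> {p + q |p q. p \<in> P \<and> q \<in> Q}}"
  then obtain c p q where "c \<in> C" "p \<in> P" "q \<in> Q" "x = c + (p + q)" by blast
  then show "x \<in> sum3 C P Q" by (intro sum3I) (auto simp: add.assoc)
qed

lemma sum3_swap: "sum3 C P Q = sum3 C Q P"
proof -
  have "sum3 C P Q \<subseteq> sum3 C Q P" for P Q
  proof (rule sum3_subset)
    fix c p q assume "c \<in> C" "p \<in> P" "q \<in> Q"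
    then show "c + p + q \<in> sum3 C Q P"
      by (intro sum3I[of c C q Q p P]) (auto simp: add_ac)
  qed
  then show ?thesis by (intro antisym)
qed

lemma sum3_rotate: "sum3 C P Q = sum3 P C Q"
proof -
  have "sum3 C P Q \<subseteq> sum3 P C Q" for C P
  proof (rule sum3_subset)
    fix c p q assume "c \<in> C" "p \<in> P" "q \<in> Q"
    then show "c + p + q \<in> sum3 P C Q"
      by (intro sum3I[of p P c C q Q]) (auto simp: add_ac)
  qed
  then show ?thesis by (intro antisym)
qed

lemma convex_sumset:
  assumes "convex S" "convex T"
  shows "convex {x + y |x y. x \<in> S \<and> y \<in> T}"
proof -
  have "{x + y |x y. x \<in> S \<and> y \<in> T} = (\<Union>x\<in>S. \<Union>y\<in>T. {x + y})" by auto
  then show ?thesis using convex_sums[OF assms] by simp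
qed

text \<open>A functional nonnegative on the sum is nonnegative on \<open>C\<close>, because both
  cones contain \<open>0\<close>, and on each cone by scaling. It is then nonnegative on every
  \<open>V i\<close>, vanishes on all of them by the positive relation, and so is zero because they
  span.\<close>

lemma alternance_interior:
  fixes C P Q :: "(real^'n) set"
  assumes C: "convex C" and P: "convex_cone P" and Q: "convex_cone Q"
    and alt: "gen_complete_alternance C P Q"
  shows "0 \<in> interior (sum3 C P Q)" and "C \<noteq> {0}"
proof -
  obtain k0 i0 V where k: "1 \<le> k0" "k0 \<le> CARD('n) + 1" "k0 \<le> i0" "i0 \<le> CARD('n) + 1"
    and V: "\<forall>i\<in>{1..k0}. V i \<in> C" "\<forall>i\<in>{k0+1..i0}. V i \<in> P" "\<forall>i\<in>{i0+1..CARD('n)+1}. V i \<in> Q"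
    and nz: "\<forall>s\<in>{1..CARD('n) + 1}. Delta V s \<noteq> 0"
    and sg: "\<forall>s\<in>{1..CARD('n)}. sgn (Delta V s) = - sgn (Delta V (s + 1))"
    using alt unfolding gen_complete_alternance_def by metis
  obtain \<alpha> where \<alpha>: "\<And>i. i \<in> {1..CARD('n) + 1} \<Longrightarrow> \<alpha> i > 0"
    and rel: "(\<Sum>i=1..CARD('n) + 1. \<alpha> i *\<^sub>R V i) = 0"
    using alternating_Delta_positive_relation[OF nz sg] by metis
  have V1: "V 1 \<in> C" using V k by auto
  show "C \<noteq> {0}"
  proof
    assume "C = {0}"
    then have "V 1 = 0" using V1 by auto
    \<comment> \<open>If \<open>V 1 = 0\<close>, the coefficients \<open>1, 0, ..., 0\<close> form a
      linear relation, and the adjacent-row identity at \<open>s = 1\<close> yields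
      \<open>Delta V 2 = 0\<close>.\<close>
    then have "(\<Sum>i=1..CARD('n) + 1. (if i = 1 then 1 else 0) *\<^sub>R V i) = 0"
      by (intro sum.neutral) auto
    then have "Delta V 2 = 0"
      using Delta_adjacent[of "\<lambda>i. if i = 1 then 1 else 0" V 1] by (simp add: Suc_le_eq numeral_2_eq_2)
    then show False
      using nz by (auto simp: Suc_le_eq)
  qed
  show "0 \<in> interior (sum3 C P Q)"
  proof (rule ccontr)
    assume *: "0 \<notin> interior (sum3 C P Q)"
    have "convex (sum3 C P Q)"
      unfolding sum3_eq using C P Q by (intro convex_sumset) (auto simp: convex_cone_def)
    then obtain a where a: "a \<noteq> 0" "\<And>x. x \<in> sum3 C P Q \<Longrightarrow> 0 \<le> a \<bullet> x"
      using * not_interior_supporting by metis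
    have a3: "0 \<le> a \<bullet> c + a \<bullet> p + a \<bullet> q" if "c \<in> C" "p \<in> P" "q \<in> Q" for c p q
      using a(2)[of "c + p + q"] that unfolding sum3_def by (auto simp: inner_add_right)
    have P0: "0 \<in> P" and Q0: "0 \<in> Q"
      using P Q convex_cone_contains_0 by auto
    have aC: "0 \<le> a \<bullet> c" if "c \<in> C" for c
      using a3[OF that P0 Q0] by simp
    \<comment> \<open>An affine function that is nonnegative for all \<open>t \<ge> 0\<close> has
      nonnegative slope: for \<open>r < 0\<close> the chosen \<open>t\<close> gives the value
      \<open>- 1\<close>.\<close>
    have large: "0 \<le> r" if "\<And>t. 0 \<le> t \<Longrightarrow> 0 \<le> b + t * r" "0 \<le> b" for b r :: real
    proof (rule ccontr)
      assume "\<not> 0 \<le> r"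
      then show False
        using that(1)[of "(b + 1) / (- r)"] that(2) by (simp add: field_simps)
    qed
    have aP: "0 \<le> a \<bullet> p" if "p \<in> P" for p
    proof (rule large[of "a \<bullet> V 1"])
      show "0 \<le> a \<bullet> V 1 + t * (a \<bullet> p)" if "0 \<le> t" for t
        using a3[OF V1 convex_cone_scaleR[OF P \<open>0 \<le> t\<close> \<open>p \<in> P\<close>] Q0] \<open>0 \<le> t\<close> by simp
    qed (rule aC[OF V1])
    have aQ: "0 \<le> a \<bullet> q" if "q \<in> Q" for q
    proof (rule large[of "a \<bullet> V 1"])
      show "0 \<le> a \<bullet> V 1 + t * (a \<bullet> q)" if "0 \<le> t" for t
        using a3[OF V1 P0 convex_cone_scaleR[OF Q \<open>0 \<le> t\<close> \<open>q \<in> Q\<close>]] \<open>0 \<le> t\<close> by simp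
    qed (rule aC[OF V1])
    have nonneg: "0 \<le> a \<bullet> V i" if "i \<in> {1..CARD('n) + 1}" for i
    proof -
      have "i \<in> {1..k0} \<or> i \<in> {k0+1..i0} \<or> i \<in> {i0+1..CARD('n)+1}"
        using that by auto
      then show ?thesis using V aC aP aQ by blast
    qed
    have "(\<Sum>i=1..CARD('n) + 1. \<alpha> i * (a \<bullet> V i)) = a \<bullet> (\<Sum>i=1..CARD('n) + 1. \<alpha> i *\<^sub>R V i)"
      by (simp only: inner_sum_right inner_scaleR_right)
    also have "\<dots> = 0"
      by (simp only: rel inner_zero_right)
    finally have "\<forall>i\<in>{1..CARD('n) + 1}. \<alpha> i * (a \<bullet> V i) = 0"
      using \<alpha> nonneg by (subst (asm) sum_nonneg_eq_0_iff) (auto intro!: mult_nonneg_nonneg simp: less_imp_le)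
    then have zero: "a \<bullet> V i = 0" if "i \<in> {1..CARD('n) + 1}" for i
      using \<alpha>[OF that] that by (metis mult_eq_0_iff less_irrefl)
    have "span (V ` {2..CARD('n) + 1}) = UNIV"
      using nz Delta_1_nonzero_iff_span[of V] by auto
    then have "a \<in> span (V ` {2..CARD('n) + 1})"
      by simp
    then have "orthogonal a a"
      by (rule orthogonal_to_span) (use zero in \<open>auto simp: orthogonal_def\<close>)
    then show False
      using a(1) by (simp add: orthogonal_def)
  qed
qed

section \<open>Selecting positively spanning vectors from three convex sets\<close>

text \<open>An alternance without enumeration and signs, which makes it symmetric in
  \<open>P\<close> and \<open>Q\<close>. The requirement on \<open>F1\<close> stands for
  \<open>1 \<le> k0\<close>.\<close>

definition spanning_selection :: "'a::euclidean_space set \<Rightarrow> 'a set \<Rightarrow> 'a set \<Rightarrow> bool" where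
  "spanning_selection C P Q \<longleftrightarrow>
     (\<exists>F1 F2 F3. F1 \<subseteq> C \<and> F2 \<subseteq> P \<and> F3 \<subseteq> Q \<and> finite F1 \<and> finite F2 \<and> finite F3 \<and> F1 \<noteq> {} \<and>
        card F1 + card F2 + card F3 \<le> DIM('a) + 1 \<and> positively_spanning (F1 \<union> F2 \<union> F3))"

lemma spanning_selectionI:
  fixes F1 :: "'a::euclidean_space set"
  assumes "F1 \<subseteq> C" "F2 \<subseteq> P" "F3 \<subseteq> Q" "finite F1" "finite F2" "finite F3" "F1 \<noteq> {}"
    and "card F1 + card F2 + card F3 \<le> DIM('a) + 1" "positively_spanning (F1 \<union> F2 \<union> F3)"
  shows "spanning_selection C P Q"
  using assms unfolding spanning_selection_def by blast

lemma spanning_selection_alternance: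
  fixes C P Q :: "(real^'n) set"
  assumes "spanning_selection C P Q"
  shows "gen_complete_alternance C P Q"
  using assms unfolding spanning_selection_def
  by (elim exE conjE, intro positively_spanning_alternance[of _ C _ P _ Q]) (auto simp: DIM_cart)

lemma spanning_selection_swap:
  assumes "spanning_selection C P Q"
  shows "spanning_selection C Q P"
proof -
  obtain F1 F2 F3 where "F1 \<subseteq> C" "F2 \<subseteq> P" "F3 \<subseteq> Q" "finite F1" "finite F2" "finite F3" "F1 \<noteq> {}"
      "card F1 + card F2 + card F3 \<le> DIM('a) + 1" "positively_spanning (F1 \<union> F2 \<union> F3)"
    using assms unfolding spanning_selection_def by blast
  then show ?thesis
    by (intro spanning_selectionI[of F1 C F3 Q F2 P]) (auto simp: Un_ac)
qed

section \<open>Simplices around a point of a convex set\<close>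

text \<open>For independent \<open>B\<close> and \<open>e > 0\<close> these are the vertices of a
  simplex in \<open>x + span B\<close> with barycentre \<open>x\<close>: the offsets
  \<open>b\<close> and \<open>- \<Sum>B\<close> sum to zero.\<close>

definition perturbations :: "'a::real_vector \<Rightarrow> real \<Rightarrow> 'a set \<Rightarrow> 'a set" where
  "perturbations x e B = insert (x - e *\<^sub>R \<Sum>B) ((\<lambda>b. x + e *\<^sub>R b) ` B)"

lemma finite_perturbations: "finite B \<Longrightarrow> finite (perturbations x e B)"
  by (simp add: perturbations_def)

lemma card_perturbations: "finite B \<Longrightarrow> card (perturbations x e B) \<le> card B + 1"
  unfolding perturbations_def
  by (metis Suc_eq_plus1 card_image_le card_insert_le_m1 finite_imageI diff_Suc_1 zero_less_Suc)

lemma sum_perturbations_nonneg: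
  fixes a :: "'a::real_inner"
  assumes B: "finite B" and a: "0 \<le> a \<bullet> (x - e *\<^sub>R \<Sum>B)" "\<And>b. b \<in> B \<Longrightarrow> 0 \<le> a \<bullet> (x + e *\<^sub>R b)"
  shows "0 \<le> a \<bullet> x"
proof -
  have "0 \<le> a \<bullet> (x - e *\<^sub>R \<Sum>B) + (\<Sum>b\<in>B. a \<bullet> (x + e *\<^sub>R b))"
    using a by (intro add_nonneg_nonneg sum_nonneg)
  also have "\<dots> = (1 + card B) * (a \<bullet> x)"
    by (simp add: algebra_simps inner_sum_right sum.distrib sum_distrib_left)
  finally show ?thesis
    by (simp add: zero_le_mult_iff)
qed

lemma nonneg_with_neg_sum_zero:
  fixes a :: "'a::real_inner"
  assumes B: "finite B" and a: "0 \<le> a \<bullet> - \<Sum>B" "\<And>b. b \<in> B \<Longrightarrow> 0 \<le> a \<bullet> b"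
    and "b \<in> B"
  shows "a \<bullet> b = 0"
proof -
  have "(\<Sum>b\<in>B. a \<bullet> b) \<le> 0"
    using a(1) by (simp add: inner_sum_right)
  then have "(\<Sum>b\<in>B. a \<bullet> b) = 0"
    using sum_nonneg[of B "\<lambda>b. a \<bullet> b"] a(2) by simp
  then show ?thesis
    using sum_nonneg_eq_0_iff[OF B] a(2) \<open>b \<in> B\<close> by blast
qed

text \<open>Averaging over the vertices gives the first claim. If \<open>a\<close> vanishes at
  \<open>x\<close>, division by \<open>e\<close> leaves nonnegative values at offsets with zero sum,
  so all of them are zero.\<close>

lemma inner_perturbations:
  fixes a :: "'a::real_inner"
  assumes "finite B" "0 < e" and a: "\<And>v. v \<in> perturbations x e B \<Longrightarrow> 0 \<le> a \<bullet> v"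
  shows "0 \<le> a \<bullet> x" and "a \<bullet> x = 0 \<Longrightarrow> b \<in> B \<Longrightarrow> a \<bullet> b = 0"
proof -
  show "0 \<le> a \<bullet> x"
    using a by (intro sum_perturbations_nonneg[OF assms(1), of a x e]) (auto simp: perturbations_def)
  assume *: "a \<bullet> x = 0" "b \<in> B"
  show "a \<bullet> b = 0"
  proof (rule nonneg_with_neg_sum_zero[OF assms(1) _ _ \<open>b \<in> B\<close>])
    have "0 \<le> a \<bullet> (x - e *\<^sub>R \<Sum>B)"
      by (rule a) (simp add: perturbations_def)
    then have "0 \<le> e * (a \<bullet> - \<Sum>B)"
      using * by (simp add: algebra_simps)
    then show "0 \<le> a \<bullet> - \<Sum>B"
      using \<open>0 < e\<close> by (simp only: zero_le_mult_iff) auto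
    fix b assume "b \<in> B"
    then have "0 \<le> a \<bullet> (x + e *\<^sub>R b)"
      by (intro a) (auto simp: perturbations_def)
    then show "0 \<le> a \<bullet> b"
      using * \<open>0 < e\<close> by (simp add: algebra_simps zero_le_mult_iff)
  qed
qed

lemma small_scaling:
  fixes x :: "'a::real_normed_vector"
  assumes "finite Z" "0 < r"
  obtains e where "0 < e" "\<And>z. z \<in> Z \<Longrightarrow> norm (e *\<^sub>R z) \<le> r"
proof -
  \<comment> \<open>The summand \<open>1\<close> keeps the divisor in \<open>r / s\<close> positive
    even if \<open>Z\<close> is empty or contains only \<open>0\<close>.\<close>
  define s where "s = 1 + (\<Sum>z\<in>Z. norm z)"
  have s: "0 < s" "norm z \<le> s" if "z \<in> Z" for z
    using member_le_sum[OF that, of norm] assms(1) sum_nonneg[of Z norm] by (auto simp: s_def)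
  have "0 < s"
    using sum_nonneg[of Z norm] by (simp add: s_def add_pos_nonneg)
  moreover have "norm ((r / s) *\<^sub>R z) \<le> r" if "z \<in> Z" for z
    using s[OF that] assms(2) by (simp add: field_simps)
  ultimately show ?thesis
    using assms(2) by (intro that[of "r / s"]) auto
qed

text \<open>With \<open>0\<close> in it, the affine hull of \<open>X\<close> is a linear subspace,
  so small moves along \<open>B\<close> and \<open>- \<Sum>B\<close> stay in it and hence in
  \<open>X\<close>.\<close>

lemma perturbations_subset:
  fixes X :: "'a::euclidean_space set"
  assumes x: "x \<in> rel_interior X" and "0 \<in> affine hull X" and B: "finite B" "B \<subseteq> affine hull X"
  obtains e where "0 < e" "perturbations x e B \<subseteq> X"
proof -
  have S: "affine hull X = span X"
    by (rule affine_hull_span_0[OF assms(2)])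
  obtain r where r: "0 < r" "cball x r \<inter> span X \<subseteq> X"
    using x S unfolding mem_rel_interior_cball by auto
  have xX: "x \<in> span X"
    using x rel_interior_subset span_base by blast
  obtain e where e: "0 < e" "\<And>z. z \<in> insert (- \<Sum>B) B \<Longrightarrow> norm (e *\<^sub>R z) \<le> r"
    using small_scaling[of "insert (- \<Sum>B) B" r] B(1) r(1) by auto
  have "x + e *\<^sub>R z \<in> X" if z: "z \<in> insert (- \<Sum>B) B" for z
  proof -
    have "z \<in> span X"
      using z B(2) unfolding S by (auto intro!: span_neg span_sum)
    then have "x + e *\<^sub>R z \<in> span X"
      by (intro span_add xX span_scale)
    moreover have "x + e *\<^sub>R z \<in> cball x r"
      using e(2)[OF z] by (simp add: dist_norm)
    ultimately show ?thesis using r by blast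
  qed
  from this[of "- \<Sum>B"] this show ?thesis
    by (intro that[OF e(1)]) (auto simp: perturbations_def)
qed

text \<open>Conic Caratheodory for two vectors; independence is what lets \<open>J\<close> be
  extended to a basis later. If \<open>p = t q\<close>, the sum is \<open>(1 + t) q\<close>; when
  \<open>1 + t < 0\<close>, also \<open>t < 0\<close>, and the sum is the nonnegative multiple
  \<open>(1 + t) / t\<close> of \<open>p\<close> instead.\<close>

lemma independent_positive_pair:
  fixes p q :: "'a::real_vector"
  obtains J \<alpha> where "J \<subseteq> {p, q}" "independent J" "\<And>j. j \<in> J \<Longrightarrow> 0 < \<alpha> j"
    "p + q = (\<Sum>j\<in>J. \<alpha> j *\<^sub>R j)"
proof -
  note witness = that
  have single: thesis if "v \<in> {p, q}" "0 \<le> t" "p + q = t *\<^sub>R v" for v t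
  proof (cases "t = 0 \<or> v = 0")
    case True
    then show thesis
      using that(3) by (intro witness[of "{}" "\<lambda>_. 1"]) (auto simp: independent_empty)
  next
    case False
    then show thesis
      using that by (intro witness[of "{v}" "\<lambda>_. t"]) auto
  qed
  consider "q = 0" | "q \<noteq> 0" "p \<in> span {q}" | "p \<noteq> q" "independent {p, q}"
    by (metis dependent_single independent_insertI span_base singletonI)
  then show thesis
  proof cases
    case 1
    then show thesis by (intro single[of p 1]) auto
  next
    case 2
    then obtain t where t: "p = t *\<^sub>R q"
      by (auto simp: span_singleton)
    show thesis
    proof (cases "0 \<le> 1 + t")
      case True
      then show thesis
        by (intro single[of q "1 + t"]) (auto simp: t algebra_simps)
    next
      case False
      have "p + q = (1 + t) *\<^sub>R q"
        by (simp add: t algebra_simps)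
      also have "\<dots> = ((1 + t) / t) *\<^sub>R p"
        using False by (simp add: t)
      finally have "p + q = ((1 + t) / t) *\<^sub>R p" .
      moreover have "0 \<le> (1 + t) / t"
        using False by (intro divide_nonpos_nonpos) auto
      ultimately show thesis
        by (intro single[of p]) auto
    qed
  next
    case 3
    then show thesis
      by (intro witness[of "{p, q}" "\<lambda>_. 1"]) auto
  qed
qed

text \<open>Starting from \<open>x0\<close> in the relative interior and any \<open>y0\<close>, the
  interior assumption supplies \<open>x + y\<close> just beyond \<open>0\<close> on the opposite
  side. Mixing the two pairs returns to \<open>0\<close>, and the positive weight on
  \<open>x0\<close> keeps the first component in the relative interior.\<close>

lemma zero_sum_rel_interior:
  fixes X Y :: "'a::euclidean_space set"
  assumes X: "convex X" and Y: "convex Y" and int: "0 \<in> interior {x + y |x y. x \<in> X \<and> y \<in> Y}"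
  obtains x y where "x \<in> rel_interior X" "y \<in> Y" "x + y = 0"
proof -
  let ?D = "{x + y |x y. x \<in> X \<and> y \<in> Y}"
  obtain r where r: "0 < r" "cball 0 r \<subseteq> ?D"
    using int unfolding mem_interior_cball by auto
  then have "0 \<in> ?D" by (meson centre_in_cball less_imp_le subsetD)
  then have "X \<noteq> {}" "Y \<noteq> {}" by auto
  then obtain x0 y0 where x0: "x0 \<in> rel_interior X" and y0: "y0 \<in> Y"
    using rel_interior_eq_empty[OF X] by auto
  obtain e where e: "0 < e" "norm (e *\<^sub>R (x0 + y0)) \<le> r"
    using small_scaling[of "{x0 + y0}" r] r(1) by auto
  then have "- (e *\<^sub>R (x0 + y0)) \<in> cball 0 r"
    by (simp only: mem_cball_0 norm_minus_cancel)
  then have "- (e *\<^sub>R (x0 + y0)) \<in> ?D"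
    using r(2) by blast
  then obtain x y where xy: "x \<in> X" "y \<in> Y" "- (e *\<^sub>R (x0 + y0)) = x + y" by blast
  \<comment> \<open>The solution of \<open>t = (1 - t) * e\<close>, the weight at which the two sums
    cancel.\<close>
  define t where "t = e / (1 + e)"
  have t: "0 < t" "t \<le> 1" "t = (1 - t) * e"
    using e(1) by (auto simp: t_def field_simps)
  show ?thesis
  proof (rule that)
    show "x - t *\<^sub>R (x - x0) \<in> rel_interior X"
      by (rule rel_interior_convex_shrink[OF X x0 xy(1) t(1,2)])
    show "(1 - t) *\<^sub>R y + t *\<^sub>R y0 \<in> Y"
      using t by (intro convexD[OF Y]) (auto simp: xy y0)
    have "x - t *\<^sub>R (x - x0) + ((1 - t) *\<^sub>R y + t *\<^sub>R y0) = (1 - t) *\<^sub>R (x + y) + t *\<^sub>R (x0 + y0)"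
      by (simp add: algebra_simps)
    also have "\<dots> = (t - (1 - t) * e) *\<^sub>R (x0 + y0)"
      unfolding xy(3)[symmetric] by (simp add: algebra_simps)
    finally show "x - t *\<^sub>R (x - x0) + ((1 - t) *\<^sub>R y + t *\<^sub>R y0) = 0"
      using t(3) by simp
  qed
qed

text \<open>The point \<open>x\<close> is perturbed only in directions \<open>B\<close> that
  complete \<open>J\<close> to a basis, which keeps the count at \<open>d + 1\<close>. A functional
  nonnegative on everything vanishes at \<open>x\<close> and on \<open>J\<close> by the positive
  relation, then on \<open>B\<close>, and so on a basis.\<close>

lemma positively_spanning_perturbation:
  fixes x :: "'a::euclidean_space"
  assumes x: "x \<in> interior X" and J: "independent J" "\<And>j. j \<in> J \<Longrightarrow> 0 < \<alpha> j"
    and rel: "x + (\<Sum>j\<in>J. \<alpha> j *\<^sub>R j) = 0"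
  obtains T where "T \<subseteq> X" "finite T" "T \<noteq> {}" "card T + card J \<le> DIM('a) + 1"
    "positively_spanning (T \<union> J)"
proof -
  obtain Bs where Bs: "J \<subseteq> Bs" "independent Bs" "UNIV \<subseteq> span Bs"
    using maximal_independent_subset_extend[of J UNIV] J(1) by auto
  define B where "B = Bs - J"
  have fin: "finite Bs" "finite J" "finite B"
    using Bs(1,2) independent_imp_finite finite_subset by (auto simp: B_def)
  have "card Bs = DIM('a)"
    using basis_card_eq_dim[of Bs UNIV] Bs by simp
  then have card: "card B + card J = DIM('a)"
    using Bs(1) fin card_mono[OF fin(1) Bs(1)] by (simp add: B_def card_Diff_subset)
  have hull: "affine hull X = UNIV"
    using affine_hull_nonempty_interior x by blast
  obtain e where e: "0 < e" "perturbations x e B \<subseteq> X"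
    using perturbations_subset[of x X B] subsetD[OF interior_subset_rel_interior x] hull fin by auto
  show ?thesis
  proof (rule that[OF e(2) finite_perturbations[OF fin(3)]])
    show "perturbations x e B \<noteq> {}" by (simp add: perturbations_def)
    show "card (perturbations x e B) + card J \<le> DIM('a) + 1"
      using card_perturbations[OF fin(3), of x e] card by simp
    show "positively_spanning (perturbations x e B \<union> J)"
      unfolding positively_spanning_def
    proof (intro allI impI)
      fix a assume a: "\<forall>v\<in>perturbations x e B \<union> J. 0 \<le> a \<bullet> v"
      note ip = inner_perturbations[OF fin(3) e(1), of x a]
      have "a \<bullet> x + (\<Sum>j\<in>J. \<alpha> j * (a \<bullet> j)) = a \<bullet> (x + (\<Sum>j\<in>J. \<alpha> j *\<^sub>R j))"
        by (simp only: inner_add_right inner_sum_right inner_scaleR_right)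
      also have "\<dots> = 0"
        by (simp only: rel inner_zero_right)
      finally have s: "a \<bullet> x + (\<Sum>j\<in>J. \<alpha> j * (a \<bullet> j)) = 0" .
      have nn: "0 \<le> \<alpha> j * (a \<bullet> j)" if "j \<in> J" for j
        using that a J(2)[OF that] by simp
      have "0 \<le> a \<bullet> x"
        using ip(1) a by blast
      then have "a \<bullet> x = 0" and "(\<Sum>j\<in>J. \<alpha> j * (a \<bullet> j)) = 0"
        using s sum_nonneg[of J "\<lambda>j. \<alpha> j * (a \<bullet> j)"] nn by auto
      then have "\<forall>j\<in>J. \<alpha> j * (a \<bullet> j) = 0"
        using sum_nonneg_eq_0_iff[of J "\<lambda>j. \<alpha> j * (a \<bullet> j)"] fin(2) nn by blast
      then have "a \<bullet> j = 0" if "j \<in> J" for j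
        using J(2)[OF that] that by (metis less_irrefl mult_eq_0_iff)
      moreover have "a \<bullet> b = 0" if "b \<in> B" for b
        using ip(2) a \<open>a \<bullet> x = 0\<close> that by blast
      ultimately have "orthogonal a b" if "b \<in> Bs" for b
        using that by (auto simp: B_def orthogonal_def)
      then have "orthogonal a a"
        using Bs(3) by (intro orthogonal_to_span[of a Bs a]) auto
      then show "a = 0" by (simp add: orthogonal_def)
    qed
  qed
qed

section \<open>Selection when one of the sets has interior points\<close>

lemma spanning_selection_interior_left:
  fixes C P Q :: "'a::euclidean_space set"
  assumes C: "convex C" and P: "convex P" and Q: "convex Q"
    and int: "interior C \<noteq> {}" and D: "0 \<in> interior (sum3 C P Q)"
  shows "spanning_selection C P Q"
proof -
  obtain c y where c: "c \<in> rel_interior C" "y \<in> {p + q |p q. p \<in> P \<and> q \<in> Q}" "c + y = 0"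
    by (rule zero_sum_rel_interior[OF C convex_sumset[OF P Q] D[unfolded sum3_eq]])
  then obtain p q where pq: "p \<in> P" "q \<in> Q" "y = p + q" by blast
  obtain J \<alpha> where J: "J \<subseteq> {p, q}" "independent J" "\<And>j. j \<in> J \<Longrightarrow> 0 < \<alpha> j"
      and sum: "p + q = (\<Sum>j\<in>J. \<alpha> j *\<^sub>R j)"
    using independent_positive_pair[of p q] by metis
  have "c \<in> interior C"
    using c(1) int rel_interior_nonempty_interior by auto
  moreover have "c + (\<Sum>j\<in>J. \<alpha> j *\<^sub>R j) = 0"
    using c(3) pq(3) sum by simp
  ultimately obtain T where T: "T \<subseteq> C" "finite T" "T \<noteq> {}" "card T + card J \<le> DIM('a) + 1"
      "positively_spanning (T \<union> J)"
    using positively_spanning_perturbation[of c C J \<alpha>] J by metis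
  have fin: "finite J" using J(1) finite_subset by blast
  \<comment> \<open>Splitting \<open>J\<close> in this way counts a vector only once even if
    \<open>p = q\<close>.\<close>
  have card: "card (J \<inter> {p}) + card (J - {p}) = card J"
    using card_Int_Diff[OF fin] by metis
  have un: "T \<union> (J \<inter> {p}) \<union> (J - {p}) = T \<union> J" by blast
  show ?thesis
    by (rule spanning_selectionI[of T C "J \<inter> {p}" P "J - {p}" Q])
      (use T J(1) pq fin card un in \<open>auto simp del: Un_Diff_cancel\<close>)
qed

text \<open>A ball around \<open>p\<close> shifted by \<open>q = - p\<close> is a ball around
  \<open>0\<close> inside the sum of the cones, and scaling it fills the space.\<close>

lemma sum_interior_cone_UNIV:
  fixes P Q :: "'a::real_normed_vector set"
  assumes P: "convex_cone P" and Q: "convex_cone Q"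
    and p: "p \<in> interior P" and q: "q \<in> Q" and "p + q = 0"
  shows "{a + b |a b. a \<in> P \<and> b \<in> Q} = UNIV"
proof -
  obtain r where r: "0 < r" "cball p r \<subseteq> P"
    using p unfolding mem_interior_cball by auto
  have "z \<in> {a + b |a b. a \<in> P \<and> b \<in> Q}" for z
  proof -
    obtain e where e: "0 < e" "norm (e *\<^sub>R z) \<le> r"
      using small_scaling[of "{z}" r] r(1) by auto
    then have "p + e *\<^sub>R z \<in> P"
      using r(2) by (auto simp: subset_eq dist_norm)
    then have "(1 / e) *\<^sub>R (p + e *\<^sub>R z) \<in> P" "(1 / e) *\<^sub>R q \<in> Q"
      using e(1) q by (auto intro!: convex_cone_scaleR[OF P] convex_cone_scaleR[OF Q])
    moreover have "(1 / e) *\<^sub>R (p + e *\<^sub>R z) + (1 / e) *\<^sub>R q = z"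
      using e(1) arg_cong[OF \<open>p + q = 0\<close>, of "scaleR (1 / e)"] by (simp add: algebra_simps)
    ultimately have "\<exists>a b. z = a + b \<and> a \<in> P \<and> b \<in> Q" by metis
    then show ?thesis by simp
  qed
  then show ?thesis by blast
qed

text \<open>Here the simplex is built in the cone \<open>P\<close>, so a vector from
  \<open>C\<close> must come from \<open>J\<close>. If \<open>c\<close> were dropped from
  \<open>J\<close>, the balance \<open>p + q' = 0\<close> would hold with some \<open>q'\<close> in
  \<open>Q\<close>, and the two cones would sum to the whole space.\<close>

lemma spanning_selection_interior_cone:
  fixes C P Q :: "'a::euclidean_space set"
  assumes C: "convex C" and P: "convex_cone P" and Q: "convex_cone Q"
    and int: "interior P \<noteq> {}" and PQ: "{a + b |a b. a \<in> P \<and> b \<in> Q} \<noteq> UNIV"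
    and D: "0 \<in> interior (sum3 C P Q)"
  shows "spanning_selection C P Q"
proof -
  have D': "0 \<in> interior (sum3 P C Q)"
    using D sum3_rotate[of C P Q] by simp
  have cP: "convex P" and cQ: "convex Q"
    using P Q by (auto simp: convex_cone_def)
  obtain p y where p: "p \<in> rel_interior P" "y \<in> {c + q |c q. c \<in> C \<and> q \<in> Q}" "p + y = 0"
    by (rule zero_sum_rel_interior[OF cP convex_sumset[OF C cQ] D'[unfolded sum3_eq]])
  then obtain c q where cq: "c \<in> C" "q \<in> Q" "y = c + q" by blast
  obtain J \<alpha> where J: "J \<subseteq> {c, q}" "independent J" "\<And>j. j \<in> J \<Longrightarrow> 0 < \<alpha> j"
      and sum: "c + q = (\<Sum>j\<in>J. \<alpha> j *\<^sub>R j)"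
    using independent_positive_pair[of c q] by metis
  have pI: "p \<in> interior P"
    using p(1) int rel_interior_nonempty_interior by auto
  have rel: "p + (\<Sum>j\<in>J. \<alpha> j *\<^sub>R j) = 0"
    using p(3) cq(3) sum by simp
  have "c \<in> J"
  proof (rule ccontr)
    assume "c \<notin> J"
    then have "J = {} \<or> J = {q}" using J(1) by auto
    then have "(\<Sum>j\<in>J. \<alpha> j *\<^sub>R j) \<in> Q"
      using J(3) cq(2) Q by (auto simp: convex_cone_contains_0 intro!: convex_cone_scaleR less_imp_le)
    then show False
      using sum_interior_cone_UNIV[OF P Q pI _ rel] PQ by blast
  qed
  obtain T where T: "T \<subseteq> P" "finite T" "T \<noteq> {}" "card T + card J \<le> DIM('a) + 1"
      "positively_spanning (T \<union> J)"
    using positively_spanning_perturbation[OF pI J(2,3) rel] by metis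
  have fin: "finite J" using J(1) finite_subset by blast
  have card: "card {c} + card (J - {c}) = card J"
    using card_Suc_Diff1[OF fin \<open>c \<in> J\<close>] by simp
  have un: "{c} \<union> T \<union> (J - {c}) = T \<union> J" using \<open>c \<in> J\<close> by blast
  show ?thesis
  proof (rule spanning_selectionI)
    show "{c} \<subseteq> C" "T \<subseteq> P" "J - {c} \<subseteq> Q" "finite {c}" "finite T" "finite (J - {c})" "{c} \<noteq> {}"
      using cq T J(1) fin by auto
    show "card {c} + card T + card (J - {c}) \<le> DIM('a) + 1"
      using card T(4) by linarith
    show "positively_spanning ({c} \<union> T \<union> (J - {c}))"
      unfolding un by (rule T(5))
  qed
qed

section \<open>Selection from a relative interior point of a cone\<close>

lemma rel_interior_segment_nonzero:
  fixes P :: "'a::euclidean_space set"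
  assumes P: "convex_cone P" and w: "w \<in> rel_interior P" "w \<noteq> 0" and s: "s \<in> P"
  obtains e where "0 < e" "e < 1" "(1 - e) *\<^sub>R w + e *\<^sub>R s \<in> rel_interior P"
    "(1 - e) *\<^sub>R w + e *\<^sub>R s \<noteq> 0"
proof -
  have ri: "(1 - e) *\<^sub>R w + e *\<^sub>R s \<in> rel_interior P" if "0 < e" "e < 1" for e
    using rel_interior_convex_shrink[of P w s "1 - e"] P w(1) s that
    by (simp add: convex_cone_def algebra_simps)
  show ?thesis
  \<comment> \<open>If the midpoint is \<open>0\<close>, then \<open>s = - w\<close>, and the weight
    \<open>1 / 3\<close> gives the nonzero point \<open>w / 3\<close>.\<close>
  proof (cases "(1 / 2) *\<^sub>R w + (1 / 2) *\<^sub>R s = 0")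
    case True
    then have "(1 / 2) *\<^sub>R (w + s) = 0" by (simp add: scaleR_add_right)
    then have "s = - w" by (simp add: eq_neg_iff_add_eq_0 add.commute)
    then have "(1 - 1 / 3) *\<^sub>R w + (1 / 3) *\<^sub>R s = (1 - 1 / 3) *\<^sub>R w - (1 / 3) *\<^sub>R w"
      by simp
    also have "\<dots> = (1 / 3) *\<^sub>R w"
      unfolding scaleR_left_diff_distrib[symmetric] by simp
    finally have "(1 - 1 / 3) *\<^sub>R w + (1 / 3) *\<^sub>R s \<noteq> 0"
      using w(2) by simp
    then show ?thesis
      by (intro that[of "1 / 3"] ri) auto
  next
    case False
    then show ?thesis
      by (intro that[of "1 / 2"] ri) auto
  qed
qed

lemma convex_cone_sum:
  assumes "convex_cone P" "\<And>b. b \<in> B \<Longrightarrow> f b \<in> P"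
  shows "sum f B \<in> P"
  using assms(2)
  by (induction B rule: infinite_finite_induct)
    (simp_all add: convex_cone_contains_0[OF assms(1)] convex_cone_add[OF assms(1)])

text \<open>Modulo the span of \<open>P\<close> the set \<open>C\<close> contains a neighbourhood of \<open>0\<close>, hence the vertices of a
  simplex around \<open>0\<close>. Contracting these vertices towards \<open>- w\<close> makes their sum a multiple of a point
  of the relative interior of \<open>- P\<close>, which a basis of the span of \<open>P\<close> taken from \<open>P\<close> balances.\<close>

lemma spanning_selection_rel_interior:
  fixes C P Q :: "'a::euclidean_space set"
  assumes C: "convex C" and P: "convex_cone P"
    and D: "0 \<in> interior {c + p |c p. c \<in> C \<and> p \<in> P}"
    and w: "w \<in> rel_interior P" "w \<noteq> 0" and mw: "- w \<in> C"
  shows "spanning_selection C P Q"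
proof -
  have hullP: "affine hull P = span P"
    by (intro affine_hull_span_0 hull_inc convex_cone_contains_0 P)
  obtain B0 where B0: "B0 \<subseteq> span P" "independent B0" "span P \<subseteq> span B0" "card B0 = dim P"
    using basis_exists[of "span P"] by (metis dim_span)
  obtain Bu where Bu: "B0 \<subseteq> Bu" "independent Bu" "UNIV \<subseteq> span Bu"
    using maximal_independent_subset_extend[of B0 UNIV] B0(2) by auto
  define B where "B = Bu - B0"
  have fin: "finite Bu" "finite B0" "finite B"
    using Bu(1,2) independent_imp_finite finite_subset by (auto simp: B_def)
  have "card Bu = DIM('a)"
    using basis_card_eq_dim[of Bu UNIV] Bu by simp
  then have card: "card B + dim P = DIM('a)"
    using Bu(1) fin card_mono[OF fin(1) Bu(1)] B0(4) by (simp add: B_def card_Diff_subset)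
  define Z where "Z = insert (- \<Sum>B) B"
  obtain r where r: "0 < r" "cball 0 r \<subseteq> {c + p |c p. c \<in> C \<and> p \<in> P}"
    using D unfolding mem_interior_cball by auto
  obtain \<delta> where \<delta>: "0 < \<delta>" "\<And>z. z \<in> Z \<Longrightarrow> norm (\<delta> *\<^sub>R z) \<le> r"
    using small_scaling[of Z r] fin(3) r(1) by (auto simp: Z_def)
  have "\<exists>c p. c \<in> C \<and> p \<in> P \<and> \<delta> *\<^sub>R z = c + p" if "z \<in> Z" for z
  proof -
    have "\<delta> *\<^sub>R z \<in> cball 0 r" using \<delta>(2)[OF that] by simp
    then show ?thesis using r(2) by blast
  qed
  then obtain c p where cp: "\<And>z. z \<in> Z \<Longrightarrow> c z \<in> C" "\<And>z. z \<in> Z \<Longrightarrow> p z \<in> P"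
    "\<And>z. z \<in> Z \<Longrightarrow> \<delta> *\<^sub>R z = c z + p z"
    by metis
  define z0 where "z0 = - \<Sum>B"
  define n where "n = 1 + real (card B)"
  have n: "0 < n" by (simp add: n_def)
  define S where "S = p z0 + (\<Sum>b\<in>B. p b)"
  have "S \<in> P"
    unfolding S_def by (intro convex_cone_add[OF P] convex_cone_sum[OF P] cp(2)) (auto simp: Z_def z0_def)
  then have "(1 / n) *\<^sub>R S \<in> P"
    using n by (intro convex_cone_scaleR[OF P]) auto
  then obtain e where e: "0 < e" "e < 1" "(1 - e) *\<^sub>R w + e *\<^sub>R (1 / n) *\<^sub>R S \<in> rel_interior P"
    "(1 - e) *\<^sub>R w + e *\<^sub>R (1 / n) *\<^sub>R S \<noteq> 0"
    using rel_interior_segment_nonzero[OF P w] by metis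
  \<comment> \<open>Here \<open>n\<close> counts \<open>z0\<close> and the elements of
    \<open>B\<close>, so that the points \<open>v z\<close> below sum to \<open>- n w'\<close>. The
    sum \<open>S\<close> is only known to lie in \<open>P\<close>; the positive weight on
    \<open>w\<close> is what puts \<open>w'\<close> in the relative interior.\<close>
  define w' where "w' = (1 - e) *\<^sub>R w + e *\<^sub>R (1 / n) *\<^sub>R S"
  have w': "w' \<in> rel_interior P" "w' \<noteq> 0" "w' \<in> P"
    using e rel_interior_subset unfolding w'_def by blast+
  \<comment> \<open>Taking the nonzero \<open>w'\<close> into the basis leaves
    \<open>dim P - 1\<close> directions, hence at most \<open>dim P\<close> perturbed points. With
    at most \<open>d - dim P + 1\<close> points of \<open>C\<close> the total is at most
    \<open>d + 1\<close>.\<close>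
  obtain Bs where Bs: "{w'} \<subseteq> Bs" "Bs \<subseteq> span P" "independent Bs" "span P \<subseteq> span Bs"
    using maximal_independent_subset_extend[of "{w'}" "span P"] w' span_base[of w' P] by auto
  define B2 where "B2 = Bs - {w'}"
  have finBs: "finite Bs" "finite B2"
    using Bs(3) independent_imp_finite by (auto simp: B2_def)
  have "card Bs = dim P"
    using basis_card_eq_dim[OF Bs(2,4,3)] by simp
  then have card2: "card B2 + 1 = dim P"
    using Bs(1) card_Suc_Diff1[OF finBs(1), of w'] by (simp add: B2_def)
  obtain e2 where e2: "0 < e2" "perturbations w' e2 B2 \<subseteq> P"
    using perturbations_subset[OF w'(1) _ finBs(2)] Bs(2) convex_cone_contains_0[OF P]
    unfolding hullP B2_def by (metis Diff_subset order_trans span_zero)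
  define v where "v z = (1 - e) *\<^sub>R (- w) + e *\<^sub>R c z" for z
  have z0Z: "z0 \<in> Z" and BZ: "\<And>b. b \<in> B \<Longrightarrow> b \<in> Z"
    by (auto simp: Z_def z0_def)
  have finZ: "finite Z" "card Z \<le> card B + 1"
    using fin(3) card_insert_le_m1[of "card B + 1"] by (auto simp: Z_def card_insert_if)
  show ?thesis
  proof (rule spanning_selectionI)
    show "v ` Z \<subseteq> C"
    proof (rule image_subsetI)
      fix z assume "z \<in> Z"
      then show "v z \<in> C"
        unfolding v_def using e(1,2) by (intro convexD[OF C mw cp(1)]) simp_all
    qed
    show "perturbations w' e2 B2 \<subseteq> P" "{} \<subseteq> Q" "finite (v ` Z)" "finite {}"
      "finite (perturbations w' e2 B2)" "v ` Z \<noteq> {}"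
      using e2 finZ finite_perturbations[OF finBs(2)] by (auto simp: Z_def)
    have "card (v ` Z) \<le> card B + 1"
      using card_image_le[OF finZ(1), of v] finZ(2) by linarith
    then show "card (v ` Z) + card (perturbations w' e2 B2) + card {} \<le> DIM('a) + 1"
      using card card2 card_perturbations[OF finBs(2), of w' e2] by simp
    show "positively_spanning (v ` Z \<union> perturbations w' e2 B2 \<union> {})"
      unfolding positively_spanning_def
    proof (intro allI impI)
      fix a assume a: "\<forall>x\<in>v ` Z \<union> perturbations w' e2 B2 \<union> {}. 0 \<le> a \<bullet> x"
      note ip = inner_perturbations[OF finBs(2) e2(1), of w' a]
      have aw: "0 \<le> a \<bullet> w'"
        using ip(1) a by blast
      have "0 = \<delta> *\<^sub>R z0 + (\<Sum>b\<in>B. \<delta> *\<^sub>R b)"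
        by (simp add: z0_def scaleR_right.sum)
      also have "\<dots> = c z0 + (\<Sum>b\<in>B. c b) + S"
        using cp(3)[OF z0Z] cp(3)[OF BZ] by (simp add: sum.distrib S_def)
      finally have cS: "c z0 + (\<Sum>b\<in>B. c b) = - S"
        by (simp add: eq_neg_iff_add_eq_0)
      have "v z0 + (\<Sum>b\<in>B. v b) = (n * (1 - e)) *\<^sub>R (- w) + e *\<^sub>R (c z0 + (\<Sum>b\<in>B. c b))"
        unfolding v_def sum.distrib
        by (simp add: n_def scaleR_right.sum[symmetric] sum_constant_scaleR algebra_simps)
      also have "\<dots> = - (n *\<^sub>R w')"
        unfolding cS w'_def using n by (simp add: scaleR_add_right)
      finally have "v z0 + (\<Sum>b\<in>B. v b) = - (n *\<^sub>R w')" .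
      moreover have "0 \<le> a \<bullet> (v z0 + (\<Sum>b\<in>B. v b))"
        unfolding inner_add_right inner_sum_right
        using a z0Z BZ by (intro add_nonneg_nonneg sum_nonneg) auto
      \<comment> \<open>The perturbed points make \<open>a\<close> nonnegative at \<open>w'\<close>,
        the points of \<open>C\<close> make it nonnegative at \<open>- n w'\<close>.\<close>
      ultimately have "0 \<le> - (n * (a \<bullet> w'))"
        by simp
      then have aw0: "a \<bullet> w' = 0"
        using aw n by (simp add: mult_le_0_iff)
      have "a \<bullet> b = 0" if "b \<in> Bs" for b
        using ip(2)[OF _ aw0, of b] a aw0 that by (cases "b = w'") (auto simp: B2_def)
      then have aP: "a \<bullet> x = 0" if "x \<in> span P" for x
        using orthogonal_to_span[of x Bs a] Bs(4) that by (auto simp: orthogonal_def)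
      \<comment> \<open>Since \<open>a\<close> vanishes on \<open>span P\<close>, the contributions
        of \<open>w\<close> and \<open>p z\<close> disappear, and only a positive multiple of
        \<open>z\<close> is left of \<open>v z\<close>.\<close>
      have nn: "0 \<le> a \<bullet> z" if "z \<in> Z" for z
      proof -
        have "a \<bullet> w = 0" "a \<bullet> p z = 0"
          using w(1) rel_interior_subset cp(2)[OF that] by (auto intro!: aP span_base)
        moreover have "c z = \<delta> *\<^sub>R z - p z"
          using cp(3)[OF that] by simp
        ultimately have "a \<bullet> v z = e * \<delta> * (a \<bullet> z)"
          by (simp add: v_def inner_add_right inner_diff_right)
        moreover have "0 \<le> a \<bullet> v z"
          using a that by blast
        ultimately show ?thesis
          using mult_pos_pos[OF e(1) \<delta>(1)] zero_le_mult_iff[of "e * \<delta>" "a \<bullet> z"] by linarith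
      qed
      have "a \<bullet> b = 0" if "b \<in> B" for b
        by (rule nonneg_with_neg_sum_zero[OF fin(3) _ _ that])
          (use nn[OF z0Z] nn[OF BZ] in \<open>auto simp: z0_def\<close>)
      moreover have "a \<bullet> b = 0" if "b \<in> B0" for b
        using aP B0(1) that by blast
      ultimately have "orthogonal a b" if "b \<in> Bu" for b
        using that by (auto simp: B_def orthogonal_def)
      then have "orthogonal a a"
        using Bu(3) by (intro orthogonal_to_span[of a Bu a]) auto
      then show "a = 0" by (simp add: orthogonal_def)
    qed
  qed
qed

text \<open>The cone contains a ball of its span around \<open>0\<close>, hence a small multiple of
  \<open>- p\<close>, and scaling gives \<open>- p\<close> itself. Such a cone is thus a linear
  subspace.\<close>

lemma rel_interior_convex_cone_zero_imp_neg:
  fixes P :: "'a::euclidean_space set"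
  assumes P: "convex_cone P" and 0: "0 \<in> rel_interior P" and p: "p \<in> P"
  shows "- p \<in> P"
proof -
  have hull: "affine hull P = span P"
    by (intro affine_hull_span_0 hull_inc convex_cone_contains_0 P)
  obtain r where r: "0 < r" "cball 0 r \<inter> span P \<subseteq> P"
    using 0 unfolding mem_rel_interior_cball hull by auto
  obtain e where e: "0 < e" "norm (e *\<^sub>R p) \<le> r"
    using small_scaling[of "{p}" r] r(1) by auto
  have "- (e *\<^sub>R p) \<in> span P"
    using p by (intro span_neg span_scale span_base)
  then have "- (e *\<^sub>R p) \<in> P"
    using r(2) e(2) by (auto simp: subset_eq)
  then show ?thesis
    using convex_cone_scaleR[OF P, of "1 / e" "- (e *\<^sub>R p)"] e(1) by simp
qed

text \<open>A balance point \<open>p\<close> in the relative interior of \<open>P\<close> serves as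
  \<open>w\<close> unless it is \<open>0\<close>. In that case \<open>0\<close> lies in
  \<open>C\<close>, so \<open>P\<close> must be pointed; being also a subspace it is
  \<open>{0}\<close>, and then \<open>C\<close> itself has \<open>0\<close> in its interior.\<close>

lemma spanning_selection_pointed:
  fixes C P Q :: "'a::euclidean_space set"
  assumes C: "convex C" and P: "convex_cone P"
    and D: "0 \<in> interior (sum3 C P {0})"
    and or: "0 \<notin> C \<or> pointed_cone P"
  shows "spanning_selection C P {0}"
proof -
  have D': "0 \<in> interior {c + p |c p. c \<in> C \<and> p \<in> P}"
    using D by (simp add: sum3_def)
  have cP: "convex P" using P by (simp add: convex_cone_def)
  obtain p c where p: "p \<in> rel_interior P" and c: "c \<in> C" "p + c = 0"
    by (rule zero_sum_rel_interior[OF cP C]) (use D sum3_rotate[of C P "{0}"] in \<open>simp add: sum3_def\<close>)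
  then have c': "- p \<in> C" by (metis minus_unique)
  show ?thesis
  proof (cases "p = 0")
    case False
    then show ?thesis
      by (rule spanning_selection_rel_interior[OF C P D' p _ c'])
  next
    case True
    then have "0 \<in> C" using c by simp
    then have point: "P \<inter> uminus ` P = {0}"
      using or by (simp add: pointed_cone_def)
    have "P \<subseteq> {0}"
    proof
      fix x assume "x \<in> P"
      then have "- x \<in> P"
        using rel_interior_convex_cone_zero_imp_neg[OF P] p True by simp
      then have "x \<in> uminus ` P" by force
      then show "x \<in> {0}" using point \<open>x \<in> P\<close> by blast
    qed
    then have "P = {0}" using convex_cone_contains_0[OF P] by blast
    then have "0 \<in> interior C" using D' by simp
    then show ?thesis
      using C cP D by (intro spanning_selection_interior_left) auto
  qed
qed

section \<open>The cones of the optimisation problem and the conclusion\<close>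

lemma cone_N_iff:
  "v \<in> cone_N G DG K x \<longleftrightarrow> (\<exists>l. (\<forall>y\<in>K. blinfun_apply l y \<le> 0) \<and> blinfun_apply l (G x) = 0 \<and>
     (\<forall>h. v \<bullet> h = blinfun_apply l (blinfun_apply (DG x) h)))"
  unfolding cone_N_def polar_cone_def mem_Collect_eq Bex_def ..

lemma convex_cone_cone_N: "convex_cone (cone_N G DG K x)"
  unfolding convex_cone_iff
proof (intro conjI ballI allI impI)
  show "0 \<in> cone_N G DG K x"
    unfolding cone_N_iff by (rule exI[of _ 0]) simp
next
  fix u v assume u: "u \<in> cone_N G DG K x" and v: "v \<in> cone_N G DG K x"
  obtain l where l: "\<forall>y\<in>K. blinfun_apply l y \<le> 0" "blinfun_apply l (G x) = 0"
    "\<forall>h. u \<bullet> h = blinfun_apply l (blinfun_apply (DG x) h)"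
    using u unfolding cone_N_iff by (elim exE conjE) (rule that)
  obtain m where m: "\<forall>y\<in>K. blinfun_apply m y \<le> 0" "blinfun_apply m (G x) = 0"
    "\<forall>h. v \<bullet> h = blinfun_apply m (blinfun_apply (DG x) h)"
    using v unfolding cone_N_iff by (elim exE conjE) (rule that)
  show "u + v \<in> cone_N G DG K x"
    unfolding cone_N_iff using l m
    by (intro exI[of _ "l + m"]) (simp add: blinfun.add_left inner_add_left add_nonpos_nonpos)
next
  fix u and t :: real assume u: "u \<in> cone_N G DG K x" and t: "0 \<le> t"
  obtain l where l: "\<forall>y\<in>K. blinfun_apply l y \<le> 0" "blinfun_apply l (G x) = 0"
    "\<forall>h. u \<bullet> h = blinfun_apply l (blinfun_apply (DG x) h)"
    using u unfolding cone_N_iff by (elim exE conjE) (rule that)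
  show "t *\<^sub>R u \<in> cone_N G DG K x"
    unfolding cone_N_iff using l t
    by (intro exI[of _ "t *\<^sub>R l"]) (simp add: blinfun.scaleR_left mult_nonneg_nonpos)
qed

lemma convex_cone_normal_cone: "convex_cone (normal_cone A x)"
  unfolding convex_cone_iff
proof (intro conjI ballI allI impI)
  show "0 \<in> normal_cone A x" by (simp add: normal_cone_def)
next
  fix u v assume "u \<in> normal_cone A x" "v \<in> normal_cone A x"
  then show "u + v \<in> normal_cone A x"
    by (simp add: normal_cone_def inner_add_left add_nonpos_nonpos)
next
  fix u and t :: real assume "u \<in> normal_cone A x" "0 \<le> t"
  then show "t *\<^sub>R u \<in> normal_cone A x"
    by (simp add: normal_cone_def mult_nonneg_nonpos)
qed

theorem theorem7:
  fixes A :: "(real^'n) set"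
    and K :: "'y::banach set"
    and W :: "'w::t2_space set"
    and f :: "real^'n \<Rightarrow> 'w \<Rightarrow> real"
    and df :: "real^'n \<Rightarrow> 'w \<Rightarrow> real^'n"
    and G :: "real^'n \<Rightarrow> 'y"
    and DG :: "real^'n \<Rightarrow> ((real^'n) \<Rightarrow>\<^sub>L 'y)"
    and xs :: "real^'n"
  assumes A_ne: "A \<noteq> {}" and A_closed: "closed A" and A_convex: "convex A"
    and K_ne: "K \<noteq> {}" and K_closed: "closed K" and K_convex: "convex K" and K_cone: "cone K"
    and W_compact: "compact W" and W_ne: "W \<noteq> {}"
    and f_grad: "\<And>x w. w \<in> W \<Longrightarrow> GDERIV (\<lambda>y. f y w) x :> df x w"
    and f_cont: "continuous_on (UNIV \<times> W) (\<lambda>(x, w). f x w)"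
    and df_cont: "continuous_on (UNIV \<times> W) (\<lambda>(x, w). df x w)"
    and G_deriv: "\<And>x. (G has_derivative blinfun_apply (DG x)) (at x)"
    and DG_cont: "continuous_on UNIV DG"
    and feasible: "G xs \<in> K" "xs \<in> A"
  defines "dF \<equiv> subdiffF f df W xs"
    and "N \<equiv> cone_N G DG K xs"
    and "NA \<equiv> normal_cone A xs"
    and "D \<equiv> sum3 (subdiffF f df W xs) (cone_N G DG K xs) (normal_cone A xs)"
  shows "(gen_complete_alternance dF N NA \<longrightarrow> 0 \<in> interior D \<and> dF \<noteq> {0})
       \<and> ((0 \<in> interior D \<and> dF \<noteq> {0} \<and>
            ( interior dF \<noteq> {}
            \<or> ({a + b |a b. a \<in> N \<and> b \<in> NA} \<noteq> UNIV \<and> (interior N \<noteq> {} \<or> interior NA \<noteq> {}))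
            \<or> (NA = {0} \<and> (\<exists>w \<in> rel_interior N - {0}. 0 \<in> (\<lambda>v. v + w) ` dF))
            \<or> (NA = {0} \<and> (0 \<notin> dF \<or> pointed_cone N))
            \<or> (N = {0} \<and> (\<exists>w \<in> rel_interior NA - {0}. 0 \<in> (\<lambda>v. v + w) ` dF))))
           \<longrightarrow> gen_complete_alternance dF N NA)"
proof -
  have C: "convex dF"
    unfolding dF_def subdiffF_def by (rule convex_convex_hull)
  have N: "convex_cone N" and NA: "convex_cone NA"
    unfolding N_def NA_def by (rule convex_cone_cone_N convex_cone_normal_cone)+
  have D: "D = sum3 dF N NA"
    unfolding D_def dF_def N_def NA_def ..
  have cN: "convex N" and cNA: "convex NA"
    using N NA by (auto simp: convex_cone_def)
  show ?thesis
  proof (intro conjI impI)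
    assume "gen_complete_alternance dF N NA"
    from alternance_interior[OF C N NA this] show "0 \<in> interior D" "dF \<noteq> {0}"
      unfolding D by auto
  next
    assume hyp: "0 \<in> interior D \<and> dF \<noteq> {0} \<and>
            ( interior dF \<noteq> {}
            \<or> ({a + b |a b. a \<in> N \<and> b \<in> NA} \<noteq> UNIV \<and> (interior N \<noteq> {} \<or> interior NA \<noteq> {}))
            \<or> (NA = {0} \<and> (\<exists>w \<in> rel_interior N - {0}. 0 \<in> (\<lambda>v. v + w) ` dF))
            \<or> (NA = {0} \<and> (0 \<notin> dF \<or> pointed_cone N))
            \<or> (N = {0} \<and> (\<exists>w \<in> rel_interior NA - {0}. 0 \<in> (\<lambda>v. v + w) ` dF)))"
    then have int: "0 \<in> interior (sum3 dF N NA)"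
      and int': "0 \<in> interior (sum3 dF NA N)"
      using sum3_swap[of dF N NA] D by auto
    have shift: "- w \<in> dF" if "0 \<in> (\<lambda>v. v + w) ` dF" for w
      using that by (auto simp: eq_neg_iff_add_eq_0[symmetric])
    have "spanning_selection dF N NA"
      using hyp
    proof (elim conjE disjE)
      assume "interior dF \<noteq> {}"
      then show ?thesis
        using spanning_selection_interior_left[OF C cN cNA] int by blast
    next
      assume "{a + b |a b. a \<in> N \<and> b \<in> NA} \<noteq> UNIV" "interior N \<noteq> {}"
      then show ?thesis
        using spanning_selection_interior_cone[OF C N NA] int by blast
    next
      assume "{a + b |a b. a \<in> N \<and> b \<in> NA} \<noteq> UNIV" "interior NA \<noteq> {}"
      \<comment> \<open>Commutativity of the two-term sum is read off from the three-term symmetry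
        with \<open>{0}\<close> in the first place.\<close>
      moreover have "{a + b |a b. a \<in> N \<and> b \<in> NA} = {a + b |a b. a \<in> NA \<and> b \<in> N}"
        using sum3_swap[of "{0}" N NA] by (simp add: sum3_def)
      ultimately show ?thesis
        by (intro spanning_selection_swap[OF spanning_selection_interior_cone[OF C NA N _ _ int']]) simp_all
    next
      assume "NA = {0}" "\<exists>w \<in> rel_interior N - {0}. 0 \<in> (\<lambda>v. v + w) ` dF"
      then obtain w where "w \<in> rel_interior N" "w \<noteq> 0" "- w \<in> dF"
        using shift by blast
      moreover have "0 \<in> interior {c + p |c p. c \<in> dF \<and> p \<in> N}"
        using int unfolding \<open>NA = {0}\<close> by (simp add: sum3_def)
      ultimately show ?thesis
        using spanning_selection_rel_interior[OF C N] by blast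
    next
      assume "NA = {0}" "0 \<notin> dF"
      then show ?thesis
        using spanning_selection_pointed[OF C N] int by simp
    next
      assume "NA = {0}" "pointed_cone N"
      then show ?thesis
        using spanning_selection_pointed[OF C N] int by simp
    next
      assume "N = {0}" "\<exists>w \<in> rel_interior NA - {0}. 0 \<in> (\<lambda>v. v + w) ` dF"
      then obtain w where "w \<in> rel_interior NA" "w \<noteq> 0" "- w \<in> dF"
        using shift by blast
      moreover have "0 \<in> interior {c + p |c p. c \<in> dF \<and> p \<in> NA}"
        using int' unfolding \<open>N = {0}\<close> by (simp add: sum3_def)
      ultimately show ?thesis
        using spanning_selection_rel_interior[OF C NA] spanning_selection_swap by blast
    qed
    then show "gen_complete_alternance dF N NA"
      by (rule spanning_selection_alternance)
  qed
qed

end
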